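(* Let $\alpha>0$, $\lambda\in\mathbb{R}$, $t_0<T$, let $K\ge1$ be an integer, let $f\in C^{K+1}([t_0,T])$, and let $c_1,\dots,c_K\in[0,1]$ be $K$ distinct nodes. Assume that each quadrature rule $\mathcal{Q}_{n,j}$ (with these $\nu=K$ nodes) has degree of precision $K-1$. Then $$y(t_n)-y_n=\frac{h^{K}P_K}{K!}\int_{t_0}^{t_n}e_{\alpha,\alpha}(t_n-s;\lambda)\,f^{(K)}(s)\,ds+\mathcal{O}\bigl(h^{K+\min\{\alpha,1\}}\bigr)$$ as $h\to0$ with $t_n=t_0+nh\in(t_0,T]$ held fixed, where $P_K=\int_0^1\pi_K(u)\,du$ and $\pi_K(u)=(u-c_1)\cdots(u-c_K)$.
   Context: $E_{\alpha,\beta}(z)=\sum_{k=0}^\infty \frac{z^k}{\Gamma(\alpha k+\beta)}$ is the Mittag--Leffler function and $e_{\alpha,\beta}(t;z)=t^{\beta-1}E_{\alpha,\beta}(-t^\alpha z)$. Let $m=\lceil\alpha\rceil$ and let $y_{0,0},\dots,y_{0,m-1}\in\mathbb{R}$ be given initial data. The function $y$ is the solution on $[t_0,T]$ of the linear fractional differential equation $D^\alpha_{t_0}y(t)+\lambda y(t)=f(t)$ (Caputo derivative of order $\alpha$ with origin $t_0$), $y^{(k)}(t_0)=y_{0,k}$ for $k=0,\dots,m-1$, that is, the function given by $$y(t)=\sum_{k=0}^{m-1}e_{\alpha,k+1}(t-t_0;\lambda)\,y_{0,k}+\int_{t_0}^t e_{\alpha,\alpha}(t-s;\lambda)f(s)\,ds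 .$$ For a step-size $h>0$ let $t_i=t_0+ih$. For $0\le j\le n-1$ put $\mathcal{I}_j[g,t_n]=\int_{t_j}^{t_{j+1}}e_{\alpha,\alpha}(t_n-s;\lambda)g(s)\,ds$ and $\mathcal{Q}_{n,j}[g]=\sum_{r=1}^{\nu} b_r(n-j)\,g(t_j+c_rh)$, with real weights $b_r(n-j)$ that may depend on $\alpha,\lambda,h$; the nodes do not depend on $h$. The rule $\mathcal{Q}_{n,j}$ has degree of precision $d$ if $\mathcal{I}_j[p,t_n]=\mathcal{Q}_{n,j}[p]$ for every polynomial $p$ of degree not exceeding $d$, but this fails for polynomials of degree $d+1$. The numerical approximation is $$y_n=\sum_{k=0}^{m-1}e_{\alpha,k+1}(t_n-t_0;\lambda)\,y_{0,k}+\sum_{j=0}^{n-1}\sum_{r=1}^{\nu}b_r(n-j)\,f(t_j+c_rh).$$ *)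

theory Defs
  imports
    "HOL-Analysis.Analysis"
    "HOL-Computational_Algebra.Polynomial"
    "HOL-Library.Landau_Symbols"
begin

definition mittag_leffler :: "real \<Rightarrow> real \<Rightarrow> real \<Rightarrow> real" where
  "mittag_leffler \<alpha> \<beta> z = (\<Sum>k. z ^ k / Gamma (\<alpha> * real k + \<beta>))"

(* The case distinction gives t^(\<beta> - 1) the value 1 when \<beta> = 1 also at t = 0,
   whereas 0 powr 0 = 0. *)
definition ml_e :: "real \<Rightarrow> real \<Rightarrow> real \<Rightarrow> real \<Rightarrow> real" where
  "ml_e \<alpha> \<beta> t z =
     (if \<beta> = 1 then 1 else t powr (\<beta> - 1)) * mittag_leffler \<alpha> \<beta> (- (t powr \<alpha>) * z)"

(* Derivatives are taken relative to S, hence one-sided at the end points of an interval. *)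
primrec nth_deriv_on :: "nat \<Rightarrow> real set \<Rightarrow> (real \<Rightarrow> real) \<Rightarrow> real \<Rightarrow> real" where
  "nth_deriv_on 0 S f = f"
| "nth_deriv_on (Suc k) S f = (\<lambda>x. vector_derivative (nth_deriv_on k S f) (at x within S))"

definition C_k_on :: "nat \<Rightarrow> real set \<Rightarrow> (real \<Rightarrow> real) \<Rightarrow> bool" where
  "C_k_on k S f \<longleftrightarrow>
     (\<forall>i<k. nth_deriv_on i S f differentiable_on S) \<and> continuous_on S (nth_deriv_on k S f)"

(* Variation-of-constants formula for the solution of the Caputo initial value problem
   D^\<alpha> y + lam y = f with origin t0 and y^(k)(t0) = y0 k for k < ceiling \<alpha>. *)
definition fde_solution ::
  "real \<Rightarrow> real \<Rightarrow> real \<Rightarrow> (nat \<Rightarrow> real) \<Rightarrow> (real \<Rightarrow> real) \<Rightarrow> real \<Rightarrow> real" where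
  "fde_solution \<alpha> lam t0 y0 f t =
     (\<Sum>k<nat \<lceil>\<alpha>\<rceil>. ml_e \<alpha> (real k + 1) (t - t0) lam * y0 k)
     + integral {t0..t} (\<lambda>s. ml_e \<alpha> \<alpha> (t - s) lam * f s)"

definition grid :: "real \<Rightarrow> real \<Rightarrow> nat \<Rightarrow> real" where
  "grid t0 h i = t0 + real i * h"

definition local_integral ::
  "real \<Rightarrow> real \<Rightarrow> real \<Rightarrow> real \<Rightarrow> nat \<Rightarrow> nat \<Rightarrow> (real \<Rightarrow> real) \<Rightarrow> real" where
  "local_integral \<alpha> lam t0 h n j g =
     integral {grid t0 h j..grid t0 h (j + 1)} (\<lambda>s. ml_e \<alpha> \<alpha> (grid t0 h n - s) lam * g s)"

(* b r i is the weight b_r(i) for the step size h, used with i = n - j. *)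
definition quadrature ::
  "nat \<Rightarrow> (nat \<Rightarrow> nat \<Rightarrow> real) \<Rightarrow> (nat \<Rightarrow> real) \<Rightarrow> real \<Rightarrow> real \<Rightarrow> nat \<Rightarrow> nat \<Rightarrow> (real \<Rightarrow> real) \<Rightarrow> real" where
  "quadrature \<nu> b c t0 h n j g = (\<Sum>r=1..\<nu>. b r (n - j) * g (grid t0 h j + c r * h))"

(* Once the rule is exact up to degree d, it fails for one polynomial of degree d + 1
   iff it fails for all of them. *)
definition degree_of_precision ::
  "real \<Rightarrow> real \<Rightarrow> nat \<Rightarrow> (nat \<Rightarrow> nat \<Rightarrow> real) \<Rightarrow> (nat \<Rightarrow> real) \<Rightarrow> real \<Rightarrow> real \<Rightarrow> nat \<Rightarrow> nat \<Rightarrow> nat \<Rightarrow> bool" where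
  "degree_of_precision \<alpha> lam \<nu> b c t0 h n j d \<longleftrightarrow>
     (\<forall>p :: real poly. degree p \<le> d \<longrightarrow>
        local_integral \<alpha> lam t0 h n j (poly p) = quadrature \<nu> b c t0 h n j (poly p)) \<and>
     (\<exists>p :: real poly. degree p = d + 1 \<and>
        local_integral \<alpha> lam t0 h n j (poly p) \<noteq> quadrature \<nu> b c t0 h n j (poly p))"

definition num_approx ::
  "real \<Rightarrow> real \<Rightarrow> nat \<Rightarrow> (nat \<Rightarrow> nat \<Rightarrow> real) \<Rightarrow> (nat \<Rightarrow> real) \<Rightarrow> real \<Rightarrow> (nat \<Rightarrow> real) \<Rightarrow> (real \<Rightarrow> real)
    \<Rightarrow> real \<Rightarrow> nat \<Rightarrow> real" where
  "num_approx \<alpha> lam \<nu> b c t0 y0 f h n =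
     (\<Sum>k<nat \<lceil>\<alpha>\<rceil>. ml_e \<alpha> (real k + 1) (grid t0 h n - t0) lam * y0 k)
     + (\<Sum>j<n. quadrature \<nu> b c t0 h n j f)"

definition node_poly :: "nat \<Rightarrow> (nat \<Rightarrow> real) \<Rightarrow> real \<Rightarrow> real" where
  "node_poly K c u = (\<Prod>r=1..K. u - c r)"

end

theory Submission
  imports Defs
begin

text \<open>On the cell starting at \<open>t\<^sub>j\<close> write \<open>f\<close> as a polynomial of degree at most \<open>K - 1\<close>, plus
  \<open>h\<^sup>K f\<^sup>(\<^sup>K\<^sup>)(t\<^sub>j) / K!\<close> times the rescaled node polynomial, plus a Taylor remainder of size \<open>O(h\<^sup>K\<^sup>+\<^sup>1)\<close>.
  The rule is exact on the first part and vanishes on the second. Its weights are integrals of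
  the kernel against Lagrange polynomials, so the remainder contributes only \<open>O(h\<^sup>K\<^sup>+\<^sup>1)\<close> in total.
  Replacing the node polynomial by its mean \<open>P\<^sub>K\<close> costs, per cell, an integral of the kernel
  against a function of mean zero, hence at most a multiple of \<open>h\<close> times the oscillation of the
  kernel. The oscillations telescope to \<open>O(h\<^bsup>min \<alpha> 1 - 1\<^esup>)\<close> away from the singularity, and the
  singular last cell has kernel mass \<open>O(h\<^sup>\<alpha>)\<close>.\<close>

section \<open>The Mittag-Leffler function\<close>

text \<open>Restrict Euler's integral to \<open>{M..M+1}\<close>: there the power is at least its
  value at \<open>M\<close> and the exponential at most its value at \<open>M + 1\<close>. Since
  \<open>M\<close> is free, Gamma outgrows every geometric sequence.\<close>

lemma Gamma_real_ge:
  fixes x M :: real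
  assumes "x \<ge> 1" "M > 0"
  shows "M powr (x - 1) / exp (M + 1) \<le> Gamma x"
proof -
  let ?g = "\<lambda>u. u powr (x - 1) / exp u"
  have G: "(?g has_integral Gamma x) {0..}"
    using assms by (intro Gamma_integral_real) auto
  have c: "continuous_on {M..M+1} ?g"
    using assms by (intro continuous_intros) auto
  have "integral {M..M+1} (\<lambda>_. M powr (x - 1) / exp (M + 1)) \<le> integral {M..M+1} ?g"
    using assms c by (intro integral_le integrable_continuous_real frac_le powr_mono2) auto
  also have "\<dots> \<le> integral {0..} ?g"
    using assms c G by (intro integral_subset_le integrable_continuous_real) auto
  also have "\<dots> = Gamma x"
    using G by (rule integral_unique)
  finally show ?thesis by simp
qed

lemma summable_mittag_leffler:
  fixes \<alpha> \<beta> z :: real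
  assumes "\<alpha> > 0"
  shows "summable (\<lambda>k. inverse (Gamma (\<alpha> * real k + \<beta>)) * z ^ k)"
proof (rule summable_comparison_test_ev)
  \<comment> \<open>With \<open>M powr \<alpha> = 2 * (\<bar>z\<bar> + 1)\<close>, Gamma grows at
    least like \<open>(2 * (\<bar>z\<bar> + 1)) ^ k\<close> up to a constant, so the terms are
    dominated by a geometric series of ratio 1/2.\<close>
  define M where "M = (2 * (\<bar>z\<bar> + 1)) powr (1 / \<alpha>)"
  define C where "C = exp (M + 1) * M powr (1 - \<beta>)"
  have M: "M > 0" unfolding M_def by simp
  have Ma: "M powr \<alpha> = 2 * (\<bar>z\<bar> + 1)"
    using assms by (simp add: M_def powr_powr)
  \<comment> \<open>The finitely many \<open>k\<close> with argument below 1, where Gamma may have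
    poles or be negative, are discarded.\<close>
  have "\<forall>\<^sub>F k in sequentially. \<alpha> * real k + \<beta> \<ge> 1"
    using eventually_ge_at_top[of "nat \<lceil>(1 - \<beta>) / \<alpha>\<rceil>"]
  proof eventually_elim
    case (elim k)
    then have "(1 - \<beta>) / \<alpha> \<le> real k" by linarith
    then show ?case using assms by (simp add: field_simps)
  qed
  then show "\<forall>\<^sub>F k in sequentially. norm (inverse (Gamma (\<alpha> * real k + \<beta>)) * z ^ k) \<le> C * (1 / 2) ^ k"
  proof eventually_elim
    case (elim k)
    have *: "M powr (\<alpha> * real k + \<beta> - 1) / exp (M + 1) \<le> Gamma (\<alpha> * real k + \<beta>)"
      using Gamma_real_ge[OF elim M] .
    have pos: "M powr (\<alpha> * real k + \<beta> - 1) / exp (M + 1) > 0" using M by simp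
    have "(2 * (\<bar>z\<bar> + 1)) ^ k = (M powr \<alpha>) ^ k"
      by (simp only: Ma)
    also have "\<dots> = M powr (\<alpha> * real k)"
      using M by (simp add: powr_powr flip: powr_realpow)
    finally have eq: "M powr (\<alpha> * real k + \<beta> - 1) = (2 * (\<bar>z\<bar> + 1)) ^ k / M powr (1 - \<beta>)"
      by (simp only: powr_diff[symmetric] diff_diff_eq2)
    have "norm (inverse (Gamma (\<alpha> * real k + \<beta>)) * z ^ k) = inverse (Gamma (\<alpha> * real k + \<beta>)) * \<bar>z\<bar> ^ k"
      using * pos by (simp add: abs_mult power_abs)
    also have "\<dots> \<le> inverse (M powr (\<alpha> * real k + \<beta> - 1) / exp (M + 1)) * (\<bar>z\<bar> + 1) ^ k"
      using * pos by (intro mult_mono le_imp_inverse_le power_mono) auto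
    also have "\<dots> = C * (1 / 2) ^ k"
      unfolding eq power_mult_distrib using M by (simp add: C_def field_simps)
    finally show ?case .
  qed
  show "summable (\<lambda>k. C * (1 / 2) ^ k :: real)"
    by (intro summable_mult summable_geometric) auto
qed

text \<open>The power series converges everywhere, so it may be differentiated termwise. The
  function and its derivative are continuous, hence bounded on \<open>{-r..r}\<close>, and the
  derivative bound serves as Lipschitz constant.\<close>

lemma mittag_leffler_bounds:
  fixes \<alpha> \<beta> r :: real
  assumes "\<alpha> > 0"
  obtains M D where "M \<ge> 0" "D \<ge> 0"
    "\<And>x. \<bar>x\<bar> \<le> r \<Longrightarrow> \<bar>mittag_leffler \<alpha> \<beta> x\<bar> \<le> M"
    "\<And>x y. \<bar>x\<bar> \<le> r \<Longrightarrow> \<bar>y\<bar> \<le> r \<Longrightarrow> \<bar>mittag_leffler \<alpha> \<beta> x - mittag_leffler \<alpha> \<beta> y\<bar> \<le> D * \<bar>x - y\<bar>"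
    "continuous_on UNIV (mittag_leffler \<alpha> \<beta>)"
proof -
  define a where "a = (\<lambda>k. inverse (Gamma (\<alpha> * real k + \<beta>)))"
  define E' where "E' = (\<lambda>x. \<Sum>k. diffs a k * x ^ k)"
  have sm: "summable (\<lambda>k. a k * x ^ k)" for x
    unfolding a_def using assms by (rule summable_mittag_leffler)
  have E: "mittag_leffler \<alpha> \<beta> = (\<lambda>x. \<Sum>k. a k * x ^ k)"
    by (simp add: fun_eq_iff mittag_leffler_def a_def field_simps)
  have der: "(mittag_leffler \<alpha> \<beta> has_field_derivative E' x) (at x)" for x
    unfolding E E'_def using sm by (rule termdiffs_strong_converges_everywhere)
  have cont: "continuous_on UNIV (mittag_leffler \<alpha> \<beta>)"
    using der DERIV_isCont by (blast intro: continuous_at_imp_continuous_on)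
  have cont': "continuous_on UNIV E'"
    unfolding E'_def
    using isCont_powser_converges_everywhere[OF termdiff_converges_all[OF sm]]
    by (intro continuous_at_imp_continuous_on) auto
  have "bounded (mittag_leffler \<alpha> \<beta> ` {-r..r})" "bounded (E' ` {-r..r})"
    using cont cont' by (auto intro!: compact_imp_bounded compact_continuous_image intro: continuous_on_subset)
  then obtain M D where "\<And>x. x \<in> {-r..r} \<Longrightarrow> \<bar>mittag_leffler \<alpha> \<beta> x\<bar> \<le> M"
      and D: "\<And>x. x \<in> {-r..r} \<Longrightarrow> \<bar>E' x\<bar> \<le> D" and MD: "M > 0" "D > 0"
    by (fastforce simp: bounded_pos)
  moreover have "\<bar>mittag_leffler \<alpha> \<beta> x - mittag_leffler \<alpha> \<beta> y\<bar> \<le> D * \<bar>x - y\<bar>"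
    if "\<bar>x\<bar> \<le> r" "\<bar>y\<bar> \<le> r" for x y
    using field_differentiable_bound[of "{-r..r}" "mittag_leffler \<alpha> \<beta>" E' D x y] that D
      has_field_derivative_at_within[OF der] by (auto simp: abs_le_iff)
  ultimately show thesis
    using that[of M D] cont by (auto simp: abs_le_iff)
qed

section \<open>The kernel near its singularity\<close>

text \<open>The singular factor of the kernel. The case distinction copies the one in
  \<open>ml_e\<close>, so that the kernel is \<open>ml_weight\<close> times a continuous function
  also at \<open>u = 0\<close>.\<close>

definition ml_weight :: "real \<Rightarrow> real \<Rightarrow> real" where
  "ml_weight \<alpha> u = (if \<alpha> = 1 then 1 else u powr (\<alpha> - 1))"

lemma ml_weight_pos: "u > 0 \<Longrightarrow> ml_weight \<alpha> u = u powr (\<alpha> - 1)"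
  by (simp add: ml_weight_def)

lemma ml_weight_nonneg: "ml_weight \<alpha> u \<ge> 0"
  by (simp add: ml_weight_def)

text \<open>The reflection \<open>s \<mapsto> t - s\<close> of the integral of a power from 0. It
  supplies the mass \<open>O(h powr \<alpha>)\<close> of the cell that ends at the
  singularity.\<close>

lemma ml_weight_has_integral:
  assumes "\<alpha> > 0" "h \<ge> 0"
  shows "((\<lambda>s. ml_weight \<alpha> (t - s)) has_integral h powr \<alpha> / \<alpha>) {t - h..t}"
proof -
  have "(ml_weight \<alpha> has_integral h powr \<alpha> / \<alpha>) {0..h}"
  proof (cases "\<alpha> = 1")
    case True
    then show ?thesis
      using assms has_integral_const_real[of "1::real" 0 h] by (simp add: ml_weight_def[abs_def])
  next
    case False
    then show ?thesis
      using assms has_integral_powr_from_0[of "\<alpha> - 1" h] by (simp add: ml_weight_def[abs_def])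
  qed
  from has_integral_affinity[of "ml_weight \<alpha>" _ 0 h "-1" t] this assms
  show ?thesis by (simp add: image_minus_const_atLeastAtMost')
qed

text \<open>The kernel is a power times \<open>G\<close>, a Mittag-Leffler function of
  \<open>- (u powr \<alpha>) * lam\<close>. Boundedness of \<open>G\<close> gives the first
  estimate; the second splits the difference as for a product rule, with the Lipschitz bound on
  \<open>G\<close> in one part and its size in the other.\<close>

lemma ml_e_kernel_bounds:
  assumes "\<alpha> > 0"
  obtains M D where "M \<ge> 0" "D \<ge> 0"
    "\<And>u. 0 \<le> u \<Longrightarrow> u \<le> L \<Longrightarrow> \<bar>ml_e \<alpha> \<alpha> u lam\<bar> \<le> M * ml_weight \<alpha> u"
    "\<And>u v. 0 < u \<Longrightarrow> u \<le> v \<Longrightarrow> v \<le> L \<Longrightarrow> \<bar>ml_e \<alpha> \<alpha> u lam - ml_e \<alpha> \<alpha> v lam\<bar>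
       \<le> D * u powr (\<alpha> - 1) * (v powr \<alpha> - u powr \<alpha>) + M * \<bar>u powr (\<alpha> - 1) - v powr (\<alpha> - 1)\<bar>"
proof -
  \<comment> \<open>Bounds the Mittag-Leffler argument for all \<open>u\<close> in
    \<open>{0..L}\<close>.\<close>
  define r where "r = L powr \<alpha> * \<bar>lam\<bar>"
  define G where "G = (\<lambda>u. mittag_leffler \<alpha> \<alpha> (- (u powr \<alpha>) * lam))"
  have e: "ml_e \<alpha> \<alpha> u lam = ml_weight \<alpha> u * G u" for u
    by (simp add: ml_e_def ml_weight_def G_def)
  obtain M D where MD: "M \<ge> 0" "D \<ge> 0"
    and M: "\<And>x. \<bar>x\<bar> \<le> r \<Longrightarrow> \<bar>mittag_leffler \<alpha> \<alpha> x\<bar> \<le> M"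
    and D: "\<And>x y. \<bar>x\<bar> \<le> r \<Longrightarrow> \<bar>y\<bar> \<le> r \<Longrightarrow> \<bar>mittag_leffler \<alpha> \<alpha> x - mittag_leffler \<alpha> \<alpha> y\<bar> \<le> D * \<bar>x - y\<bar>"
    using mittag_leffler_bounds[OF assms] by metis
  have arg: "\<bar>- (u powr \<alpha>) * lam\<bar> \<le> r" if "0 \<le> u" "u \<le> L" for u
    using that assms by (auto simp: r_def abs_mult intro!: mult_right_mono powr_mono2)
  have GM: "\<bar>G u\<bar> \<le> M" if "0 \<le> u" "u \<le> L" for u
    unfolding G_def using M[OF arg[OF that]] .
  have GD: "\<bar>G u - G v\<bar> \<le> (D * \<bar>lam\<bar>) * (v powr \<alpha> - u powr \<alpha>)" if "0 < u" "u \<le> v" "v \<le> L" for u v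
  proof -
    have "\<bar>G u - G v\<bar> \<le> D * \<bar>(- (u powr \<alpha>) * lam) - (- (v powr \<alpha>) * lam)\<bar>"
      unfolding G_def using that by (intro D arg) auto
    also have "(- (u powr \<alpha>) * lam) - (- (v powr \<alpha>) * lam) = (v powr \<alpha> - u powr \<alpha>) * lam"
      by (simp add: algebra_simps)
    also have "\<bar>\<dots>\<bar> = (v powr \<alpha> - u powr \<alpha>) * \<bar>lam\<bar>"
      using that assms by (simp add: abs_mult powr_mono2)
    finally show ?thesis by (simp add: mult_ac)
  qed
  show thesis
  proof (rule that[of M "D * \<bar>lam\<bar>"])
    fix u assume "0 \<le> u" "u \<le> L"
    then show "\<bar>ml_e \<alpha> \<alpha> u lam\<bar> \<le> M * ml_weight \<alpha> u"
      using mult_right_mono[OF GM ml_weight_nonneg] by (simp add: e abs_mult ml_weight_nonneg mult.commute)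
  next
    fix u v assume uv: "0 < u" "u \<le> v" "v \<le> L"
    let ?p = "u powr (\<alpha> - 1)" and ?q = "v powr (\<alpha> - 1)"
    have "\<bar>ml_e \<alpha> \<alpha> u lam - ml_e \<alpha> \<alpha> v lam\<bar> = \<bar>?p * (G u - G v) + (?p - ?q) * G v\<bar>"
      using uv by (simp add: e ml_weight_pos algebra_simps)
    also have "\<dots> \<le> ?p * \<bar>G u - G v\<bar> + \<bar>?p - ?q\<bar> * \<bar>G v\<bar>"
      by (rule order_trans[OF abs_triangle_ineq]) (simp add: abs_mult)
    also have "\<dots> \<le> ?p * ((D * \<bar>lam\<bar>) * (v powr \<alpha> - u powr \<alpha>)) + \<bar>?p - ?q\<bar> * M"
      using uv GM[of v] GD[OF uv] by (intro add_mono mult_left_mono) auto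
    finally show "\<bar>ml_e \<alpha> \<alpha> u lam - ml_e \<alpha> \<alpha> v lam\<bar>
       \<le> D * \<bar>lam\<bar> * ?p * (v powr \<alpha> - u powr \<alpha>) + M * \<bar>?p - ?q\<bar>"
      by (simp add: mult_ac)
  qed (use MD in auto)
qed

text \<open>Oscillations are bounded by increments of one function \<open>g\<close>, so that summing
  them over adjacent cells telescopes to \<open>g L - g h\<close>. The function \<open>g\<close> may
  depend on \<open>h\<close>, but \<open>C\<close> may not.\<close>

lemma ml_e_kernel_oscillation:
  assumes "\<alpha> > 0" "L > 0"
  obtains C where "C \<ge> 0"
    "\<And>h. 0 < h \<Longrightarrow> h \<le> L \<Longrightarrow> \<exists>g. (\<forall>u v. h \<le> u \<longrightarrow> u \<le> v \<longrightarrow> v \<le> L \<longrightarrow>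
        \<bar>ml_e \<alpha> \<alpha> u lam - ml_e \<alpha> \<alpha> v lam\<bar> \<le> g v - g u) \<and> g L - g h \<le> C * h powr (min \<alpha> 1 - 1)"
proof -
  obtain M D where MD: "M \<ge> 0" "D \<ge> 0"
    and D: "\<And>u v. 0 < u \<Longrightarrow> u \<le> v \<Longrightarrow> v \<le> L \<Longrightarrow> \<bar>ml_e \<alpha> \<alpha> u lam - ml_e \<alpha> \<alpha> v lam\<bar>
       \<le> D * u powr (\<alpha> - 1) * (v powr \<alpha> - u powr \<alpha>) + M * \<bar>u powr (\<alpha> - 1) - v powr (\<alpha> - 1)\<bar>"
    using ml_e_kernel_bounds[OF assms(1), of L lam] by metis
  show thesis
  proof (cases "\<alpha> \<ge> 1")
    case True
    \<comment> \<open>For \<open>\<alpha> \<ge> 1\<close> both powers increase,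
      \<open>u powr (\<alpha> - 1)\<close> is at most \<open>L powr (\<alpha> - 1)\<close>, and the
      factor \<open>h powr (min \<alpha> 1 - 1)\<close> equals 1; one \<open>g\<close> serves all
      \<open>h\<close>.\<close>
    define g where "g = (\<lambda>x. D * L powr (\<alpha> - 1) * x powr \<alpha> + M * x powr (\<alpha> - 1))"
    have "\<bar>ml_e \<alpha> \<alpha> u lam - ml_e \<alpha> \<alpha> v lam\<bar> \<le> g v - g u" if "0 < u" "u \<le> v" "v \<le> L" for u v
    proof -
      have "D * u powr (\<alpha> - 1) * (v powr \<alpha> - u powr \<alpha>) \<le> D * L powr (\<alpha> - 1) * (v powr \<alpha> - u powr \<alpha>)"
        using True that MD by (intro mult_right_mono mult_left_mono powr_mono2) (auto intro: powr_mono2)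
      moreover have "\<bar>u powr (\<alpha> - 1) - v powr (\<alpha> - 1)\<bar> = v powr (\<alpha> - 1) - u powr (\<alpha> - 1)"
        using True that by (simp add: powr_mono2)
      ultimately show ?thesis
        using D[OF that] by (simp add: g_def algebra_simps)
    qed
    moreover have "g L - g h \<le> g L * h powr (min \<alpha> 1 - 1)" if "0 < h" for h
    proof -
      have "0 \<le> g h" using MD by (simp add: g_def)
      then show ?thesis using True that by simp
    qed
    moreover have "g L \<ge> 0" using MD by (simp add: g_def)
    ultimately show thesis
      by (intro that[of "g L"] exI[of _ g]) auto
  next
    case False
    have "\<exists>g. (\<forall>u v. h \<le> u \<longrightarrow> u \<le> v \<longrightarrow> v \<le> L \<longrightarrow>
        \<bar>ml_e \<alpha> \<alpha> u lam - ml_e \<alpha> \<alpha> v lam\<bar> \<le> g v - g u)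
        \<and> g L - g h \<le> (D * L powr \<alpha> + M) * h powr (min \<alpha> 1 - 1)" if h: "0 < h" "h \<le> L" for h
    proof (intro exI conjI allI impI)
      \<comment> \<open>For \<open>\<alpha> < 1\<close> the power \<open>\<alpha> - 1\<close>
        decreases: it is largest at \<open>h\<close>, which brings \<open>h\<close> into the first
        coefficient, and it enters with a minus sign to make \<open>?g\<close> increasing.\<close>
      let ?g = "\<lambda>x. D * h powr (\<alpha> - 1) * x powr \<alpha> - M * x powr (\<alpha> - 1)"
      fix u v assume uv: "h \<le> u" "u \<le> v" "v \<le> L"
      have "D * u powr (\<alpha> - 1) * (v powr \<alpha> - u powr \<alpha>) \<le> D * h powr (\<alpha> - 1) * (v powr \<alpha> - u powr \<alpha>)"
        using assms False h uv MD
        by (intro mult_right_mono mult_left_mono powr_mono2') (auto intro: powr_mono2)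
      moreover have "\<bar>u powr (\<alpha> - 1) - v powr (\<alpha> - 1)\<bar> = u powr (\<alpha> - 1) - v powr (\<alpha> - 1)"
        using False h uv by (simp add: powr_mono2')
      ultimately show "\<bar>ml_e \<alpha> \<alpha> u lam - ml_e \<alpha> \<alpha> v lam\<bar> \<le> ?g v - ?g u"
        using D[of u v] h uv by (simp add: algebra_simps)
    next
      have "0 \<le> D * h powr (\<alpha> - 1) * h powr \<alpha>" "0 \<le> M * L powr (\<alpha> - 1)"
        using MD by auto
      then show "D * h powr (\<alpha> - 1) * L powr \<alpha> - M * L powr (\<alpha> - 1)
          - (D * h powr (\<alpha> - 1) * h powr \<alpha> - M * h powr (\<alpha> - 1))
          \<le> (D * L powr \<alpha> + M) * h powr (min \<alpha> 1 - 1)"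
        using False by (simp add: algebra_simps)
    qed
    moreover have "D * L powr \<alpha> + M \<ge> 0" using MD by simp
    ultimately show thesis by (rule that[rotated])
  qed
qed

section \<open>Absolute integrability of the kernel and of its products with continuous
  functions\<close>

lemma absolutely_integrable_mult_continuous:
  fixes k g :: "real \<Rightarrow> real"
  assumes "k absolutely_integrable_on {a..b}" "continuous_on {a..b} g"
  shows "(\<lambda>s. k s * g s) absolutely_integrable_on {a..b}"
proof -
  have "(\<lambda>s. g s * k s) absolutely_integrable_on {a..b}"
    using assms
    by (intro absolutely_integrable_bounded_measurable_product_real continuous_imp_measurable_on_sets_lebesgue
        compact_imp_bounded compact_continuous_image) auto
  then show ?thesis by (simp add: mult.commute)
qed

text \<open>The weight is nonnegative and integrable despite its possible singularity at
  \<open>s = t\<close>; the remaining Mittag-Leffler factor is continuous up to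
  \<open>t\<close>.\<close>

lemma ml_e_kernel_absolutely_integrable:
  assumes "\<alpha> > 0"
  shows "(\<lambda>s. ml_e \<alpha> \<alpha> (t - s) lam) absolutely_integrable_on {a..t}"
proof (cases "a \<le> t")
  case True
  have "(\<lambda>s. ml_weight \<alpha> (t - s)) absolutely_integrable_on {a..t}"
    using ml_weight_has_integral[OF assms, of "t - a" t] True
    by (intro nonnegative_absolutely_integrable_1) (auto simp: ml_weight_nonneg integrable_on_def)
  moreover have "continuous_on {a..t} (\<lambda>s. mittag_leffler \<alpha> \<alpha> (- ((t - s) powr \<alpha>) * lam))"
  proof (rule continuous_on_compose2[of UNIV "mittag_leffler \<alpha> \<alpha>"])
    show "continuous_on UNIV (mittag_leffler \<alpha> \<alpha>)"
      using mittag_leffler_bounds[OF assms] by metis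
    show "continuous_on {a..t} (\<lambda>s. - ((t - s) powr \<alpha>) * lam)"
      using assms by (intro continuous_intros continuous_on_powr') auto
  qed auto
  ultimately show ?thesis
    using absolutely_integrable_mult_continuous by (fastforce simp: ml_e_def ml_weight_def)
qed auto

section \<open>Quadrature error on one cell\<close>

definition lagrange_poly :: "nat \<Rightarrow> (nat \<Rightarrow> real) \<Rightarrow> nat \<Rightarrow> real poly" where
  "lagrange_poly K c r = (\<Prod>i\<in>{1..K} - {r}. smult (1 / (c r - c i)) [:- c i, 1:])"

lemma poly_lagrange_poly:
  assumes "inj_on c {1..K}" "r \<in> {1..K}" "i \<in> {1..K}"
  shows "poly (lagrange_poly K c r) (c i) = (if i = r then 1 else 0)"
proof (cases "i = r")
  case True
  have "c r \<noteq> c j" if "j \<in> {1..K} - {r}" for j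
    using assms that by (auto dest: inj_onD)
  then show ?thesis
    using True by (auto simp: lagrange_poly_def poly_prod intro!: prod.neutral simp: diff_divide_distrib[symmetric])
next
  case False
  then show ?thesis
    using assms by (auto simp: lagrange_poly_def poly_prod intro!: prod_zero)
qed

lemma degree_lagrange_poly:
  assumes "r \<in> {1..K}"
  shows "degree (lagrange_poly K c r) \<le> K - 1"
proof -
  have "degree (lagrange_poly K c r) \<le> (\<Sum>i\<in>{1..K} - {r}. degree (smult (1 / (c r - c i)) [:- c i, 1:]))"
    unfolding lagrange_poly_def by (rule order_trans[OF degree_prod_sum_le]) (auto simp: comp_def)
  also have "\<dots> \<le> (\<Sum>i\<in>{1..K} - {r}. 1)"
    by (intro sum_mono) (auto simp: degree_smult_eq)
  also have "\<dots> = K - 1" using assms by (simp add: card_Diff_subset)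
  finally show ?thesis .
qed

lemma degree_monic_diff_less:
  fixes p q :: "'a::comm_ring_1 poly"
  assumes "degree p = n" "degree q = n" "lead_coeff p = 1" "lead_coeff q = 1" "n > 0"
  shows "degree (p - q) \<le> n - 1"
proof (rule degree_le, intro allI impI)
  fix i assume "n - 1 < i"
  then have "i = n \<or> i > n" using assms by linarith
  then show "coeff (p - q) i = 0"
    using assms by (auto simp: coeff_eq_0)
qed

lemma node_poly_bound:
  assumes "\<And>r. r \<in> {1..K} \<Longrightarrow> c r \<in> {0..1}" "u \<in> {0..1}"
  shows "\<bar>node_poly K c u\<bar> \<le> 1"
  unfolding node_poly_def abs_prod using assms by (intro prod_le_1) (force simp: abs_le_iff)

lemma continuous_on_node_poly: "continuous_on S (node_poly K c)"
  unfolding node_poly_def[abs_def] by (intro continuous_intros)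

lemma node_poly_node: "r \<in> {1..K} \<Longrightarrow> node_poly K c (c r) = 0"
  by (auto simp: node_poly_def)

text \<open>The factor \<open>h ^ K\<close> makes the node polynomial of the cell monic of degree
  \<open>K\<close> in \<open>s\<close>, so subtracting \<open>(s - a) ^ K\<close> cancels the
  leading term. Thus the order \<open>K\<close> Taylor term can be traded for a multiple of the node
  polynomial, modulo polynomials on which the rule is exact.\<close>

lemma node_poly_expansion:
  assumes "K \<ge> 1" "h \<noteq> 0"
  obtains q :: "real poly" where "degree q \<le> K - 1"
    "\<And>s. h ^ K * node_poly K c ((s - a) / h) = (s - a) ^ K + poly q s"
proof -
  define p where "p = (\<Prod>r=1..K. [:- (a + c r * h), 1:])"
  have p: "poly p s = h ^ K * node_poly K c ((s - a) / h)" for s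
  proof -
    have "h ^ K * node_poly K c ((s - a) / h) = (\<Prod>r=1..K. h * ((s - a) / h - c r))"
      by (simp add: node_poly_def prod.distrib)
    also have "\<dots> = (\<Prod>r=1..K. s - (a + c r * h))"
      using assms by (intro prod.cong) (auto simp: field_simps)
    finally show ?thesis by (simp add: p_def poly_prod algebra_simps)
  qed
  have "degree p = K" "lead_coeff p = 1"
    unfolding p_def lead_coeff_prod by (simp_all add: degree_prod_eq_sum_degree)
  then have "degree (p - [:-a, 1:] ^ K) \<le> K - 1"
    using assms by (intro degree_monic_diff_less) (auto simp: degree_linear_power coeff_linear_power)
  then show thesis
    by (rule that) (simp add: p poly_power)
qed

text \<open>Exactness on the \<open>r\<close>-th Lagrange polynomial isolates \<open>w r\<close>,
  because that polynomial is 1 at its own node and 0 at the others. The weight is thus an integral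
  against the kernel.\<close>

lemma quadrature_weight_bound:
  fixes k :: "real \<Rightarrow> real"
  assumes k: "k absolutely_integrable_on {a..a+h}" and h: "h > 0"
    and c: "inj_on c {1..K}" and r: "r \<in> {1..K}"
    and exact: "\<And>p. degree p \<le> K - 1 \<Longrightarrow>
      integral {a..a+h} (\<lambda>s. k s * poly p s) = (\<Sum>r=1..K. w r * poly p (a + c r * h))"
    and bnd: "\<And>u. u \<in> {0..1} \<Longrightarrow> \<bar>poly (lagrange_poly K c r) u\<bar> \<le> B"
  shows "\<bar>w r\<bar> \<le> B * integral {a..a+h} (\<lambda>s. \<bar>k s\<bar>)"
proof -
  \<comment> \<open>The Lagrange polynomial carried from \<open>{0..1}\<close> to the cell; its
    bound \<open>B\<close> therefore does not depend on \<open>h\<close>.\<close>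
  define p where "p = pcompose (lagrange_poly K c r) [:- a / h, 1 / h:]"
  have p: "poly p s = poly (lagrange_poly K c r) ((s - a) / h)" for s
    by (simp add: p_def poly_pcompose diff_divide_distrib add.commute)
  have "degree p \<le> degree (lagrange_poly K c r) * degree [:- a / h, 1 / h:]"
    unfolding p_def by (rule degree_pcompose_le)
  also have "\<dots> \<le> K - 1"
    using h degree_lagrange_poly[OF r, of c] by simp
  finally have "integral {a..a+h} (\<lambda>s. k s * poly p s) = (\<Sum>r=1..K. w r * poly p (a + c r * h))"
    by (rule exact)
  also have "\<dots> = (\<Sum>i=1..K. if i = r then w i else 0)"
    using h c r by (intro sum.cong) (auto simp: p poly_lagrange_poly)
  also have "\<dots> = w r" using r by simp
  finally have "w r = integral {a..a+h} (\<lambda>s. k s * poly p s)" ..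
  also have "norm \<dots> \<le> integral {a..a+h} (\<lambda>s. B * \<bar>k s\<bar>)"
  proof (rule integral_norm_bound_integral)
    show "(\<lambda>s. k s * poly p s) integrable_on {a..a+h}"
      using k by (intro set_lebesgue_integral_eq_integral(1) absolutely_integrable_mult_continuous continuous_intros)
    show "(\<lambda>s. B * \<bar>k s\<bar>) integrable_on {a..a+h}"
      using k by (auto intro!: integrable_on_mult_right simp: absolutely_integrable_on_def)
    fix s assume "s \<in> {a..a+h}"
    then have "\<bar>poly p s\<bar> \<le> B" unfolding p using h by (intro bnd) (auto simp: field_simps)
    then show "norm (k s * poly p s) \<le> B * \<bar>k s\<bar>"
      by (simp add: abs_mult mult.commute[of B] mult_left_mono)
  qed
  finally show ?thesis by simp
qed

text \<open>Split \<open>F 0\<close> into a polynomial of degree at most \<open>K - 1\<close>, a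
  multiple of the node polynomial, and a Taylor remainder. The first has no quadrature error, the
  second has quadrature value 0 and leaves the displayed integral, and the third is estimated in
  both the integral and the sum. The set \<open>S\<close> may exceed the cell, because the
  derivatives are taken relative to the whole interval.\<close>

lemma quadrature_cell_error:
  fixes k :: "real \<Rightarrow> real" and F :: "nat \<Rightarrow> real \<Rightarrow> real"
  assumes K: "K \<ge> 1"
    and k: "k absolutely_integrable_on {a..a+h}" and h: "h > 0"
    and c: "\<And>r. r \<in> {1..K} \<Longrightarrow> c r \<in> {0..1}"
    and exact: "\<And>p. degree p \<le> K - 1 \<Longrightarrow>
      integral {a..a+h} (\<lambda>s. k s * poly p s) = (\<Sum>r=1..K. w r * poly p (a + c r * h))"
    and w: "\<And>r. r \<in> {1..K} \<Longrightarrow> \<bar>w r\<bar> \<le> W * integral {a..a+h} (\<lambda>s. \<bar>k s\<bar>)"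
    and S: "convex S" "{a..a+h} \<subseteq> S"
    and F: "\<And>i x. x \<in> S \<Longrightarrow> i \<le> K \<Longrightarrow> (F i has_field_derivative F (Suc i) x) (at x within S)"
    and B: "\<And>x. x \<in> S \<Longrightarrow> \<bar>F (Suc K) x\<bar> \<le> B"
  shows "\<bar>integral {a..a+h} (\<lambda>s. k s * F 0 s) - (\<Sum>r=1..K. w r * F 0 (a + c r * h))
      - h ^ K / fact K * F K a * integral {a..a+h} (\<lambda>s. k s * node_poly K c ((s - a) / h))\<bar>
      \<le> (1 + real K * W) * B * h ^ (K + 1) * integral {a..a+h} (\<lambda>s. \<bar>k s\<bar>)" (is "?E \<le> _")
proof -
  let ?I = "\<lambda>g. integral {a..a+h} (\<lambda>s. k s * g s)"
  let ?Q = "\<lambda>g. \<Sum>r=1..K. w r * g (a + c r * h)"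
  let ?N = "integral {a..a+h} (\<lambda>s. \<bar>k s\<bar>)"
  let ?node = "\<lambda>s. node_poly K c ((s - a) / h)"
  define A where "A = h ^ K / fact K * F K a"
  define R where "R = (\<lambda>s. F 0 s - (\<Sum>i\<le>K. F i a * (s - a) ^ i / fact i))"
  have aS: "a \<in> S" using S h by auto
  have R: "\<bar>R s\<bar> \<le> B * h ^ (K + 1)" if "s \<in> {a..a+h}" for s
  proof -
    have "0 \<le> B" using B[OF aS] by linarith
    have "\<bar>R s\<bar> \<le> B * \<bar>s - a\<bar> ^ Suc K / fact K"
      using field_Taylor[of S K F B a s] S F B aS that unfolding R_def by auto
    also have "\<dots> \<le> B * h ^ Suc K / 1"
      using \<open>0 \<le> B\<close> that by (intro frac_le mult_left_mono power_mono) auto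
    finally show ?thesis by simp
  qed
  obtain q where q: "degree q \<le> K - 1" "\<And>s. h ^ K * ?node s = (s - a) ^ K + poly q s"
    using node_poly_expansion[of K h c a] K h by auto
  \<comment> \<open>The Taylor terms below order \<open>K\<close>, with \<open>q\<close> correcting
    the replacement of \<open>(s - a) ^ K\<close> by the rescaled node polynomial.\<close>
  define P where "P = (\<Sum>i<K. smult (F i a / fact i) ([:- a, 1:] ^ i)) - smult (F K a / fact K) q"
  have "degree P \<le> K - 1"
    unfolding P_def
  proof (intro degree_diff_le degree_sum_le)
    show "degree (smult (F K a / fact K) q) \<le> K - 1"
      using q(1) degree_smult_le order_trans by blast
    show "degree (smult (F i a / fact i) ([:- a, 1:] ^ i)) \<le> K - 1" if "i \<in> {..<K}" for i
      using that by (intro order_trans[OF degree_smult_le]) (auto simp: degree_linear_power)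
  qed auto
  note IP = exact[OF this]
  have F0: "F 0 s = poly P s + R s + A * ?node s" for s
  proof -
    have "A * ?node s = F K a / fact K * (h ^ K * ?node s)" by (simp add: A_def)
    also have "\<dots> = F K a * (s - a) ^ K / fact K + F K a / fact K * poly q s"
      unfolding q(2) by (simp add: field_simps)
    moreover have "(\<Sum>i\<le>K. F i a * (s - a) ^ i / fact i)
        = (\<Sum>i<K. F i a * (s - a) ^ i / fact i) + F K a * (s - a) ^ K / fact K"
      by (simp flip: lessThan_Suc_atMost)
    ultimately show ?thesis
      by (simp add: R_def P_def poly_sum poly_power)
  qed
  have cF: "continuous_on {a..a+h} (F 0)"
    using F[of _ 0] S by (blast intro: continuous_on_subset DERIV_continuous_on)
  have cR: "continuous_on {a..a+h} R"
    unfolding R_def by (intro continuous_intros cF) auto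
  have cN: "continuous_on {a..a+h} ?node"
    by (intro continuous_on_compose2[OF continuous_on_node_poly[of UNIV]] continuous_intros) (use h in auto)
  have cP: "continuous_on {a..a+h} (poly P)"
    by (intro continuous_at_imp_continuous_on ballI poly_isCont)
  have int: "(\<lambda>s. k s * g s) integrable_on {a..a+h}" if "continuous_on {a..a+h} g" for g
    using k that by (intro set_lebesgue_integral_eq_integral(1) absolutely_integrable_mult_continuous)
  have "?I (F 0) = integral {a..a+h} (\<lambda>s. (k s * poly P s + k s * R s) + A * (k s * ?node s))"
    unfolding F0 by (simp add: algebra_simps)
  also have "\<dots> = ?I (poly P) + ?I R + A * ?I ?node"
    using int[OF cR] int[OF cN] int[OF cP]
    by (simp add: Henstock_Kurzweil_Integration.integral_add integrable_add integrable_on_mult_right)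
  finally have I: "?I (F 0) = ?I (poly P) + ?I R + A * ?I ?node" .
  \<comment> \<open>All quadrature points are zeros of the node polynomial, so the rule sees only
    \<open>P\<close> and \<open>R\<close>.\<close>
  have "?node (a + c r * h) = 0" if "r \<in> {1..K}" for r
    using node_poly_node[OF that, of c] h by simp
  then have "?Q (F 0) = (\<Sum>r=1..K. w r * poly P (a + c r * h) + w r * R (a + c r * h))"
    by (intro sum.cong) (auto simp: F0 algebra_simps)
  then have Q: "?Q (F 0) = ?Q (poly P) + ?Q R" by (simp add: sum.distrib)
  have IR: "\<bar>?I R\<bar> \<le> B * h ^ (K + 1) * ?N"
  proof -
    have "norm (?I R) \<le> integral {a..a+h} (\<lambda>s. B * h ^ (K + 1) * \<bar>k s\<bar>)"
    proof (rule integral_norm_bound_integral[OF int[OF cR]])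
      show "(\<lambda>s. B * h ^ (K + 1) * \<bar>k s\<bar>) integrable_on {a..a+h}"
        using k by (intro integrable_on_mult_right) (auto simp: absolutely_integrable_on_def)
      show "norm (k s * R s) \<le> B * h ^ (K + 1) * \<bar>k s\<bar>" if "s \<in> {a..a+h}" for s
        using mult_left_mono[OF R[OF that], of "\<bar>k s\<bar>"] by (simp add: abs_mult mult_ac)
    qed
    then show ?thesis by simp
  qed
  have QR: "\<bar>?Q R\<bar> \<le> real K * (W * ?N * (B * h ^ (K + 1)))"
  proof -
    have "\<bar>?Q R\<bar> \<le> (\<Sum>r=1..K. \<bar>w r * R (a + c r * h)\<bar>)" by (rule sum_abs)
    also have "\<dots> \<le> (\<Sum>r=1..K. W * ?N * (B * h ^ (K + 1)))"
    proof (rule sum_mono)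
      fix r assume r: "r \<in> {1..K}"
      have "a + c r * h \<in> {a..a+h}" using c[OF r] h by (auto simp: mult_left_le_one_le)
      from R[OF this] w[OF r] show "\<bar>w r * R (a + c r * h)\<bar> \<le> W * ?N * (B * h ^ (K + 1))"
        unfolding abs_mult by (intro mult_mono) auto
    qed
    finally show ?thesis by simp
  qed
  have "?E = \<bar>?I R - ?Q R\<bar>"
    unfolding I Q IP by (simp add: A_def)
  also have "\<dots> \<le> B * h ^ (K + 1) * ?N + real K * (W * ?N * (B * h ^ (K + 1)))"
    using IR QR by linarith
  finally show ?thesis by (simp add: algebra_simps)
qed

section \<open>Composite rules\<close>

text \<open>Since \<open>q\<close> has mean zero, the constant \<open>k a\<close> can be subtracted
  from \<open>k\<close> without changing the integral; what remains is at most \<open>V * Q\<close>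
  on a cell of length \<open>h\<close>.\<close>

lemma integral_mult_mean_zero_bound:
  fixes k q :: "real \<Rightarrow> real"
  assumes k: "k absolutely_integrable_on {a..a+h}" and h: "h > 0"
    and q: "continuous_on {0..1} q" "integral {0..1} q = 0"
    and Q: "\<And>u. u \<in> {0..1} \<Longrightarrow> \<bar>q u\<bar> \<le> Q"
    and V: "\<And>s. s \<in> {a..a+h} \<Longrightarrow> \<bar>k s - k a\<bar> \<le> V"
  shows "\<bar>integral {a..a+h} (\<lambda>s. k s * q ((s - a) / h))\<bar> \<le> Q * V * h"
proof -
  have unit: "(s - a) / h \<in> {0..1}" if "s \<in> {a..a+h}" for s
    using that h by (auto simp: field_simps)
  have cq: "continuous_on {a..a+h} (\<lambda>s. q ((s - a) / h))"
    by (rule continuous_on_compose2[OF q(1)]) (use h unit in \<open>auto intro!: continuous_intros\<close>)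
  have "(q has_integral 0) (cbox 0 1)"
    using integrable_integral[OF integrable_continuous_real[OF q(1)]] q(2) by simp
  moreover have "(0 - (- a / h)) /\<^sub>R (1 / h) = a" "(1 - (- a / h)) /\<^sub>R (1 / h) = a + h"
    using h by (simp_all add: field_simps)
  \<comment> \<open>The affine substitution carries the vanishing mean from \<open>{0..1}\<close> to
    the cell.\<close>
  ultimately have 0: "((\<lambda>s. q ((s - a) / h)) has_integral 0) {a..a+h}"
    using has_integral_affinity'[of q 0 0 1 "1 / h" "- a / h"] h
    by (simp add: diff_divide_distrib)
  have i: "(\<lambda>s. k s * q ((s - a) / h)) integrable_on {a..a+h}"
    using k cq by (intro set_lebesgue_integral_eq_integral(1) absolutely_integrable_mult_continuous)
  have "((\<lambda>s. k s * q ((s - a) / h) - k a * q ((s - a) / h)) has_integral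
      (integral {a..a+h} (\<lambda>s. k s * q ((s - a) / h)) - k a * 0)) {a..a+h}"
    by (intro has_integral_diff integrable_integral i has_integral_mult_right 0)
  then have d: "((\<lambda>s. (k s - k a) * q ((s - a) / h)) has_integral
      integral {a..a+h} (\<lambda>s. k s * q ((s - a) / h))) {a..a+h}"
    by (simp add: algebra_simps)
  then have "norm (integral {a..a+h} (\<lambda>s. (k s - k a) * q ((s - a) / h))) \<le> integral {a..a+h} (\<lambda>_. V * Q)"
  proof (intro integral_norm_bound_integral)
    fix s assume s: "s \<in> {a..a+h}"
    show "norm ((k s - k a) * q ((s - a) / h)) \<le> V * Q"
      unfolding real_norm_def abs_mult using V[OF s] Q[OF unit[OF s]] by (intro mult_mono) auto
  qed (auto simp: integrable_on_def)
  then show ?thesis using d h by (simp add: integral_unique[OF d] mult_ac)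
qed

lemma integral_uniform_partition:
  fixes g :: "real \<Rightarrow> real"
  assumes "h \<ge> 0" "g integrable_on {a..a + real n * h}"
  shows "integral {a..a + real n * h} g = (\<Sum>j<n. integral {a + real j * h..a + real j * h + h} g)"
  using assms(2)
proof (induction n)
  case (Suc n)
  have e: "a + real (Suc n) * h = a + real n * h + h" by (simp add: algebra_simps)
  have "g integrable_on {a..a + real n * h}"
    using Suc.prems by (rule integrable_on_subinterval) (use assms e in auto)
  moreover have "integral {a..a + real n * h} g + integral {a + real n * h..a + real n * h + h} g
      = integral {a..a + real n * h + h} g"
    using assms(1) Suc.prems unfolding e by (intro Henstock_Kurzweil_Integration.integral_combine) auto
  ultimately show ?case using Suc.IH unfolding e by simp
qed simp

text \<open>On each cell two further replacements lead to the claimed leading term: the node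
  polynomial by its mean \<open>P\<close>, at cost \<open>V j\<close>, and \<open>F K\<close> at the
  left end point by \<open>F K s\<close>, at cost \<open>B * h\<close> times the kernel mass. The
  bounds \<open>V j\<close> stay abstract because the singular cell needs a different one.\<close>

lemma composite_quadrature_error:
  fixes k :: "real \<Rightarrow> real" and F :: "nat \<Rightarrow> real \<Rightarrow> real" and c :: "nat \<Rightarrow> real" and K :: nat
  defines "P \<equiv> integral {0..1} (node_poly K c)"
  assumes K: "K \<ge> 1"
    and k: "k absolutely_integrable_on {a..a + real n * h}" and h: "h > 0"
    and c: "\<And>r. r \<in> {1..K} \<Longrightarrow> c r \<in> {0..1}" "inj_on c {1..K}"
    and exact: "\<And>j p. j < n \<Longrightarrow> degree p \<le> K - 1 \<Longrightarrow>
      integral {a + real j * h..a + real j * h + h} (\<lambda>s. k s * poly p s)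
        = (\<Sum>r=1..K. w j r * poly p (a + real j * h + c r * h))"
    and W: "\<And>u r. u \<in> {0..1} \<Longrightarrow> r \<in> {1..K} \<Longrightarrow> \<bar>poly (lagrange_poly K c r) u\<bar> \<le> W"
    and S: "convex S" "{a..a + real n * h} \<subseteq> S"
    and F: "\<And>i x. x \<in> S \<Longrightarrow> i \<le> K \<Longrightarrow> (F i has_field_derivative F (Suc i) x) (at x within S)"
    and A: "\<And>x. x \<in> S \<Longrightarrow> \<bar>F K x\<bar> \<le> A"
    and B: "\<And>x. x \<in> S \<Longrightarrow> \<bar>F (Suc K) x\<bar> \<le> B"
    and V: "\<And>j. j < n \<Longrightarrow> \<bar>integral {a + real j * h..a + real j * h + h}
        (\<lambda>s. k s * (node_poly K c ((s - (a + real j * h)) / h) - P))\<bar> \<le> V j"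
  shows "\<bar>integral {a..a + real n * h} (\<lambda>s. k s * F 0 s)
      - (\<Sum>j<n. \<Sum>r=1..K. w j r * F 0 (a + real j * h + c r * h))
      - h ^ K * P / fact K * integral {a..a + real n * h} (\<lambda>s. k s * F K s)\<bar>
      \<le> (1 + real K * W + \<bar>P\<bar>) * B * h ^ (K + 1) * integral {a..a + real n * h} (\<lambda>s. \<bar>k s\<bar>)
        + h ^ K * A * (\<Sum>j<n. V j)" (is "\<bar>?I (\<lambda>s. k s * F 0 s) - (\<Sum>j<n. ?Q j) - ?c * ?I (\<lambda>s. k s * F K s)\<bar> \<le> _")
proof -
  let ?x = "\<lambda>j. a + real j * h"
  let ?J = "\<lambda>j. integral {?x j..?x j + h}"
  have sub: "{?x j..?x j + h} \<subseteq> {a..a + real n * h}" if "j < n" for j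
  proof -
    have "real (j + 1) * h \<le> real n * h" using that h by (intro mult_right_mono) auto
    then show ?thesis using h by (auto simp: algebra_simps intro: order_trans[rotated])
  qed
  have cF: "continuous_on {a..a + real n * h} (F i)" if "i \<le> K" for i
    using F[of _ i] S that by (blast intro: continuous_on_subset DERIV_continuous_on)
  have int: "(\<lambda>s. k s * g s) integrable_on {a..a + real n * h}" if "continuous_on {a..a + real n * h} g" for g
    using k that by (intro set_lebesgue_integral_eq_integral(1) absolutely_integrable_mult_continuous)
  have kabs: "(\<lambda>s. \<bar>k s\<bar>) integrable_on {a..a + real n * h}"
    using k by (auto simp: absolutely_integrable_on_def)
  have cell: "\<bar>?J j (\<lambda>s. k s * F 0 s) - ?Q j - ?c * ?J j (\<lambda>s. k s * F K s)\<bar>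
      \<le> (1 + real K * W + \<bar>P\<bar>) * B * h ^ (K + 1) * ?J j (\<lambda>s. \<bar>k s\<bar>) + h ^ K * A * V j" if j: "j < n" for j
  proof -
    let ?node = "\<lambda>s. node_poly K c ((s - ?x j) / h)"
    let ?N = "?J j (\<lambda>s. \<bar>k s\<bar>)"
    let ?X = "{?x j..?x j + h}"
    have xS: "s \<in> S" if "s \<in> ?X" for s using that sub[OF j] S by blast
    have x: "?x j \<in> S" using h by (intro xS) auto
    have A0: "0 \<le> A" using A[OF x] by linarith
    have kj: "k absolutely_integrable_on ?X"
      using k sub[OF j] by (rule absolutely_integrable_on_subinterval)
    have intj: "(\<lambda>s. k s * g s) integrable_on ?X" if "continuous_on ?X g" for g
      using kj that by (intro set_lebesgue_integral_eq_integral(1) absolutely_integrable_mult_continuous)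
    have cFj: "continuous_on ?X (F K)" using cF[of K] sub[OF j] continuous_on_subset by blast
    have cN: "continuous_on ?X ?node"
      by (intro continuous_on_compose2[OF continuous_on_node_poly[of UNIV]] continuous_intros) (use h in auto)
    have E1: "\<bar>?J j (\<lambda>s. k s * F 0 s) - ?Q j - h ^ K / fact K * F K (?x j) * ?J j (\<lambda>s. k s * ?node s)\<bar>
        \<le> (1 + real K * W) * B * h ^ (K + 1) * ?N"
    proof (rule quadrature_cell_error[OF K kj h c(1) exact[OF j] _ S(1) _ F B])
      show "\<bar>w j r\<bar> \<le> W * ?N" if "r \<in> {1..K}" for r
        using quadrature_weight_bound[OF kj h c(2) that exact[OF j] W] that by blast
      show "?X \<subseteq> S" using xS by blast
    qed
    have E2: "?J j (\<lambda>s. k s * (?node s - P)) = ?J j (\<lambda>s. k s * ?node s) - P * ?J j k"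
    proof -
      have "?J j (\<lambda>s. k s * ?node s - P * k s) = ?J j (\<lambda>s. k s * ?node s) - ?J j (\<lambda>s. P * k s)"
        using intj[OF cN] intj[of "\<lambda>_. P"]
        by (intro Henstock_Kurzweil_Integration.integral_diff) (auto simp: mult.commute)
      then show ?thesis by (simp add: algebra_simps)
    qed
    have E3: "\<bar>?J j (\<lambda>s. k s * F K s) - F K (?x j) * ?J j k\<bar> \<le> B * h * ?N"
    proof -
      have "?J j (\<lambda>s. k s * F K s - F K (?x j) * k s) = ?J j (\<lambda>s. k s * F K s) - ?J j (\<lambda>s. F K (?x j) * k s)"
        using intj[OF cFj] intj[of "\<lambda>_. F K (?x j)"]
        by (intro Henstock_Kurzweil_Integration.integral_diff) (auto simp: mult.commute)
      then have "?J j (\<lambda>s. k s * F K s) - F K (?x j) * ?J j k = ?J j (\<lambda>s. k s * (F K s - F K (?x j)))"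
        by (simp add: algebra_simps)
      also have "norm \<dots> \<le> integral ?X (\<lambda>s. B * h * \<bar>k s\<bar>)"
      proof (rule integral_norm_bound_integral)
        show "(\<lambda>s. k s * (F K s - F K (?x j))) integrable_on ?X"
          by (intro intj continuous_intros cFj)
        show "(\<lambda>s. B * h * \<bar>k s\<bar>) integrable_on ?X"
          using kj by (intro integrable_on_mult_right) (auto simp: absolutely_integrable_on_def)
        fix s assume s: "s \<in> ?X"
        have "0 \<le> B" using B[OF x] by linarith
        have "\<bar>F K s - F K (?x j)\<bar> \<le> B * \<bar>s - ?x j\<bar>"
          using field_differentiable_bound[OF S(1) F[of _ K] _ xS[OF s] x, of B] B by auto
        also have "\<dots> \<le> B * h" using s \<open>0 \<le> B\<close> by (intro mult_left_mono) auto
        finally show "norm (k s * (F K s - F K (?x j))) \<le> B * h * \<bar>k s\<bar>"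
          by (simp add: abs_mult mult.commute[of "\<bar>k s\<bar>"] mult_right_mono)
      qed
      finally show ?thesis by simp
    qed
    \<comment> \<open>Adding and subtracting \<open>P\<close> times \<open>F K (?x j)\<close> times
      the kernel integral separates the two replacements.\<close>
    have eq: "h ^ K / fact K * F K (?x j) * ?J j (\<lambda>s. k s * ?node s) - ?c * ?J j (\<lambda>s. k s * F K s)
        = h ^ K / fact K * (F K (?x j) * ?J j (\<lambda>s. k s * (?node s - P))
            - P * (?J j (\<lambda>s. k s * F K s) - F K (?x j) * ?J j k))"
      unfolding E2 by (simp add: field_simps)
    have "\<bar>F K (?x j) * ?J j (\<lambda>s. k s * (?node s - P)) - P * (?J j (\<lambda>s. k s * F K s) - F K (?x j) * ?J j k)\<bar>
        \<le> \<bar>F K (?x j) * ?J j (\<lambda>s. k s * (?node s - P))\<bar> + \<bar>P * (?J j (\<lambda>s. k s * F K s) - F K (?x j) * ?J j k)\<bar>"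
      by linarith
    also have "\<dots> \<le> A * V j + \<bar>P\<bar> * (B * h * ?N)"
      unfolding abs_mult using A[OF x] V[OF j] E3 A0 by (intro add_mono mult_mono) auto
    finally have "\<bar>h ^ K / fact K * F K (?x j) * ?J j (\<lambda>s. k s * ?node s) - ?c * ?J j (\<lambda>s. k s * F K s)\<bar>
        \<le> h ^ K * (A * V j + \<bar>P\<bar> * (B * h * ?N))"
      unfolding eq abs_mult using h by (intro mult_mono) (auto simp: field_simps)
    with E1 have "\<bar>?J j (\<lambda>s. k s * F 0 s) - ?Q j - ?c * ?J j (\<lambda>s. k s * F K s)\<bar>
        \<le> (1 + real K * W) * B * h ^ (K + 1) * ?N + h ^ K * (A * V j + \<bar>P\<bar> * (B * h * ?N))"
      by linarith
    then show ?thesis by (simp add: algebra_simps)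
  qed
  have part: "?I g = (\<Sum>j<n. ?J j g)" if "g integrable_on {a..a + real n * h}" for g
    using integral_uniform_partition[OF less_imp_le[OF h] that] .
  have eq: "?I (\<lambda>s. k s * F 0 s) - (\<Sum>j<n. ?Q j) - ?c * ?I (\<lambda>s. k s * F K s)
      = (\<Sum>j<n. ?J j (\<lambda>s. k s * F 0 s) - ?Q j - ?c * ?J j (\<lambda>s. k s * F K s))"
    by (simp add: part int cF sum_subtractf sum_distrib_left)
  have "\<bar>\<Sum>j<n. ?J j (\<lambda>s. k s * F 0 s) - ?Q j - ?c * ?J j (\<lambda>s. k s * F K s)\<bar>
      \<le> (\<Sum>j<n. (1 + real K * W + \<bar>P\<bar>) * B * h ^ (K + 1) * ?J j (\<lambda>s. \<bar>k s\<bar>) + h ^ K * A * V j)"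
    using cell by (intro order_trans[OF sum_abs] sum_mono) auto
  then show ?thesis
    unfolding eq part[OF kabs] sum.distrib sum_distrib_left .
qed

section \<open>The asymptotic error expansion\<close>

lemma nth_deriv_on_has_field_derivative:
  assumes "C_k_on k S f" "i < k" "x \<in> S"
  shows "(nth_deriv_on i S f has_field_derivative nth_deriv_on (Suc i) S f x) (at x within S)"
proof -
  have "nth_deriv_on i S f differentiable at x within S"
    using assms by (auto simp: C_k_on_def differentiable_on_def)
  then show ?thesis
    by (simp add: has_real_derivative_iff_has_vector_derivative vector_derivative_works)
qed

lemma C_k_on_bounded:
  assumes "C_k_on k S f" "i \<le> k" "compact S"
  obtains B where "\<And>x. x \<in> S \<Longrightarrow> \<bar>nth_deriv_on i S f x\<bar> \<le> B"
proof -
  have "continuous_on S (nth_deriv_on i S f)"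
    using assms by (cases "i = k") (auto simp: C_k_on_def intro: differentiable_imp_continuous_on)
  then have "bounded (nth_deriv_on i S f ` S)"
    using assms by (intro compact_imp_bounded compact_continuous_image)
  then show thesis
    using that by (auto simp: bounded_iff)
qed

text \<open>Keeping \<open>t\<close> fixed as the \<open>n\<close>-th grid point forces the step
  \<open>(t - t0) / n\<close>, so the limit \<open>h \<rightarrow> 0\<close> is taken along
  \<open>n \<rightarrow> \<infinity>\<close>. The first argument of \<open>b\<close> is the step
  size.\<close>

theorem proposition4p3:
  fixes \<alpha> lam t0 T :: real
    and K :: nat
    and f :: "real \<Rightarrow> real"
    and y0 :: "nat \<Rightarrow> real"
    and c :: "nat \<Rightarrow> real"
    and b :: "real \<Rightarrow> nat \<Rightarrow> nat \<Rightarrow> real"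
    and t :: real
  assumes "\<alpha> > 0"
    and "t0 < T"
    and "K \<ge> 1"
    and "C_k_on (K + 1) {t0..T} f"
    and "\<And>r. r \<in> {1..K} \<Longrightarrow> c r \<in> {0..1}"
    and "inj_on c {1..K}"
    and "\<And>h n j. h > 0 \<Longrightarrow> j < n \<Longrightarrow> grid t0 h n \<le> T \<Longrightarrow>
           degree_of_precision \<alpha> lam K (b h) c t0 h n j (K - 1)"
    and "t \<in> {t0<..T}"
  defines "h \<equiv> \<lambda>n :: nat. (t - t0) / real n"
  shows "(\<lambda>n. fde_solution \<alpha> lam t0 y0 f t - num_approx \<alpha> lam K (b (h n)) c t0 y0 f (h n) n
            - h n ^ K * integral {0..1} (node_poly K c) / fact K
              * integral {t0..t} (\<lambda>s. ml_e \<alpha> \<alpha> (t - s) lam * nth_deriv_on K {t0..T} f s))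
         \<in> O(\<lambda>n. h n powr (real K + min \<alpha> 1))"
proof -
  let ?S = "{t0..T}" and ?F = "\<lambda>i. nth_deriv_on i {t0..T} f"
  let ?err = "\<lambda>n. fde_solution \<alpha> lam t0 y0 f t - num_approx \<alpha> lam K (b (h n)) c t0 y0 f (h n) n
            - h n ^ K * integral {0..1} (node_poly K c) / fact K
              * integral {t0..t} (\<lambda>s. ml_e \<alpha> \<alpha> (t - s) lam * ?F K s)"
  define L where "L = t - t0"
  define k where "k = (\<lambda>s. ml_e \<alpha> \<alpha> (t - s) lam)"
  define P where "P = integral {0..1} (node_poly K c)"
  define \<mu> where "\<mu> = min \<alpha> 1"
  have L: "L > 0" "t0 + L = t" and tT: "t \<le> T" using assms(8) by (auto simp: L_def)
  obtain A where A: "\<And>x. x \<in> ?S \<Longrightarrow> \<bar>?F K x\<bar> \<le> A"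
    using C_k_on_bounded[OF assms(4), of K] by auto
  obtain B where B: "\<And>x. x \<in> ?S \<Longrightarrow> \<bar>?F (Suc K) x\<bar> \<le> B"
    using C_k_on_bounded[OF assms(4), of "Suc K"] by auto
  have AB: "0 \<le> A" "0 \<le> B"
    using A[of t0] B[of t0] assms(2) by fastforce+
  have "\<exists>W. \<forall>u\<in>{0..1}. \<bar>poly (lagrange_poly K c r) u\<bar> \<le> W" for r
  proof -
    have "bounded (poly (lagrange_poly K c r) ` {0..1})"
      by (intro compact_imp_bounded compact_continuous_image continuous_at_imp_continuous_on ballI poly_isCont) auto
    then show ?thesis by (auto simp: bounded_iff)
  qed
  then obtain W' where W': "\<And>r u. u \<in> {0..1} \<Longrightarrow> \<bar>poly (lagrange_poly K c r) u\<bar> \<le> W' r"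
    by metis
  define W where "W = Max (W' ` {1..K})"
  have W: "\<bar>poly (lagrange_poly K c r) u\<bar> \<le> W" if "u \<in> {0..1}" "r \<in> {1..K}" for u r
    using W'[OF that(1)] that(2) unfolding W_def by (intro order_trans[OF W' Max_ge]) (use that in auto)
  have W0: "0 \<le> W" using W[of 0 1] assms(3) by auto
  obtain M where M: "M \<ge> 0" "\<And>u. 0 \<le> u \<Longrightarrow> u \<le> L \<Longrightarrow> \<bar>ml_e \<alpha> \<alpha> u lam\<bar> \<le> M * ml_weight \<alpha> u"
    using ml_e_kernel_bounds[OF assms(1), of L lam] by metis
  obtain C where C: "C \<ge> 0"
    and osc: "\<And>h. 0 < h \<Longrightarrow> h \<le> L \<Longrightarrow> \<exists>g. (\<forall>u v. h \<le> u \<longrightarrow> u \<le> v \<longrightarrow> v \<le> L \<longrightarrow>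
        \<bar>ml_e \<alpha> \<alpha> u lam - ml_e \<alpha> \<alpha> v lam\<bar> \<le> g v - g u) \<and> g L - g h \<le> C * h powr (\<mu> - 1)"
    using ml_e_kernel_oscillation[OF assms(1) L(1), of lam] unfolding \<mu>_def by metis
  have k: "k absolutely_integrable_on {t0..t}"
    unfolding k_def using assms(1) by (rule ml_e_kernel_absolutely_integrable)
  have cont: "continuous_on {0..1} (\<lambda>u. node_poly K c u - P)"
    by (intro continuous_intros continuous_on_node_poly)
  have mean: "integral {0..1} (\<lambda>u. node_poly K c u - P) = 0"
    by (subst Henstock_Kurzweil_Integration.integral_diff)
      (auto simp: P_def intro: integrable_continuous_real continuous_on_node_poly)
  \<comment> \<open>On \<open>{0..1}\<close> the node polynomial has modulus at most 1, hence so
    does its mean.\<close>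
  have dev: "\<bar>node_poly K c u - P\<bar> \<le> 2" if "u \<in> {0..1}" for u
  proof -
    have node: "\<bar>node_poly K c v\<bar> \<le> 1" if "v \<in> {0..1}" for v
      by (rule node_poly_bound[OF assms(5) that])
    have "norm P \<le> integral {0..1::real} (\<lambda>_. 1 :: real)"
      unfolding P_def
    proof (rule integral_norm_bound_integral)
      show "node_poly K c integrable_on {0..1}"
        by (intro integrable_continuous_real continuous_on_node_poly)
    qed (use node in auto)
    then show ?thesis using node[OF that] by auto
  qed
  define N where "N = integral {t0..t} (\<lambda>s. \<bar>k s\<bar>)"
  have N: "0 \<le> N" unfolding N_def by (rule Henstock_Kurzweil_Integration.integral_nonneg)
      (use k in \<open>auto simp: absolutely_integrable_on_def\<close>)
  \<comment> \<open>\<open>C1\<close> collects the errors of order \<open>K + 1\<close>. In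
    \<open>C2\<close>, which bounds the cost of passing to the mean, the part with \<open>C\<close>
    comes from the regular cells and the part with \<open>M\<close> from the singular one.\<close>
  define C1 where "C1 = (1 + real K * W + \<bar>P\<bar>) * B * N"
  define C2 where "C2 = A * (2 * C + 2 * M * L powr (\<alpha> - \<mu>) / \<alpha>)"
  have C12: "0 \<le> C1" "0 \<le> C2"
    using AB W0 N C M assms(1) by (auto simp: C1_def C2_def)
  have main: "norm (?err n) \<le> (C1 * L powr (1 - \<mu>) + C2) * norm (h n powr (real K + \<mu>))" if n: "n \<ge> 1" for n
  proof -
    define d where "d = h n"
    let ?x = "\<lambda>j. t0 + real j * d"
    have d: "0 < d" "d \<le> L" and nd: "real n * d = L"
      using n L by (auto simp: d_def h_def L_def[symmetric] field_simps)
    have gn: "grid t0 d n = t" using nd L by (simp add: grid_def)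
    obtain g where g: "\<And>u v. d \<le> u \<Longrightarrow> u \<le> v \<Longrightarrow> v \<le> L \<Longrightarrow> \<bar>ml_e \<alpha> \<alpha> u lam - ml_e \<alpha> \<alpha> v lam\<bar> \<le> g v - g u"
      and gL: "g L - g d \<le> C * d powr (\<mu> - 1)"
      using osc[OF d] by metis
    \<comment> \<open>\<open>G j\<close> is \<open>g\<close> at the distance from the
      \<open>j\<close>-th grid point to \<open>t\<close>. The last cell, \<open>j = n - 1\<close>,
      is bounded by its kernel mass; the others by the oscillation of the kernel. The factor 2 in
      both cases is the bound \<open>dev\<close>.\<close>
    define G where "G = (\<lambda>j. g (L - real j * d))"
    define V where "V = (\<lambda>j. if j = n - 1 then 2 * M * (d powr \<alpha> / \<alpha>) else 2 * (G j - G (Suc j)) * d)"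
    have V: "\<bar>integral {?x j..?x j + d} (\<lambda>s. k s * (node_poly K c ((s - ?x j) / d) - P))\<bar> \<le> V j"
      if j: "j < n" for j
    proof -
      have x1: "?x j + d \<le> t"
      proof -
        have "real (j + 1) * d \<le> real n * d" using j d by (intro mult_right_mono) auto
        then show ?thesis using nd L by (simp add: algebra_simps)
      qed
      have x0: "t0 \<le> ?x j" using d by simp
      have kj: "k absolutely_integrable_on {?x j..?x j + d}"
        using k by (rule absolutely_integrable_on_subinterval) (use x0 x1 in auto)
      show ?thesis
      proof (cases "j = n - 1")
        case True
        then have xj: "?x j + d = t" "?x j = t - d" using j n nd L by (auto simp: of_nat_diff algebra_simps)
        have "norm (integral {?x j..?x j + d} (\<lambda>s. k s * (node_poly K c ((s - ?x j) / d) - P)))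
            \<le> integral {?x j..?x j + d} (\<lambda>s. 2 * M * ml_weight \<alpha> (t - s))"
        proof (rule integral_norm_bound_integral)
          show "(\<lambda>s. k s * (node_poly K c ((s - ?x j) / d) - P)) integrable_on {?x j..?x j + d}"
            using kj d
            by (intro set_lebesgue_integral_eq_integral(1) absolutely_integrable_mult_continuous continuous_intros
                continuous_on_compose2[OF continuous_on_node_poly[of UNIV]]) auto
          show "(\<lambda>s. 2 * M * ml_weight \<alpha> (t - s)) integrable_on {?x j..?x j + d}"
            using ml_weight_has_integral[OF assms(1), of d t] d unfolding xj
            by (intro integrable_on_mult_right) (auto simp: integrable_on_def)
          fix s assume s: "s \<in> {?x j..?x j + d}"
          from s x0 x1 have "0 \<le> t - s" "t - s \<le> L"
            unfolding atLeastAtMost_iff L_def by linarith+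
          then have "\<bar>k s\<bar> \<le> M * ml_weight \<alpha> (t - s)"
            unfolding k_def by (rule M(2))
          moreover have "\<bar>node_poly K c ((s - ?x j) / d) - P\<bar> \<le> 2"
            using s d by (intro dev) (auto simp: field_simps)
          ultimately have "\<bar>k s\<bar> * \<bar>node_poly K c ((s - ?x j) / d) - P\<bar> \<le> M * ml_weight \<alpha> (t - s) * 2"
            by (intro mult_mono) (auto simp: M ml_weight_nonneg)
          then show "norm (k s * (node_poly K c ((s - ?x j) / d) - P)) \<le> 2 * M * ml_weight \<alpha> (t - s)"
            by (simp add: abs_mult mult_ac)
        qed
        also have "\<dots> = 2 * M * (d powr \<alpha> / \<alpha>)"
          using integral_unique[OF ml_weight_has_integral[OF assms(1), of d t]] d unfolding xj by simp
        finally show ?thesis using True by (simp add: V_def)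
      next
        case False
        \<comment> \<open>Every cell but the last stays at distance at least \<open>d\<close> from
          \<open>t\<close>, which is where the oscillation bound is available.\<close>
        have far: "?x (Suc j) \<le> t - d"
        proof -
          have "real (j + 2) * d \<le> real n * d" using j False d by (intro mult_right_mono) auto
          then show ?thesis using nd L by (simp add: algebra_simps)
        qed
        have "\<bar>k s - k (?x j)\<bar> \<le> G j - G (Suc j)" if s: "s \<in> {?x j..?x j + d}" for s
        proof -
          have "?x (Suc j) = ?x j + d" by (simp add: algebra_simps)
          with s far x0 have "d \<le> t - ?x (Suc j)" "t - ?x (Suc j) \<le> t - s" "t - s \<le> t - ?x j" "t - ?x j \<le> L"
            unfolding atLeastAtMost_iff L_def by linarith+
          \<comment> \<open>Monotonicity of \<open>g\<close> enlarges the increment up to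
            \<open>s\<close> to that of the whole cell.\<close>
          then have "\<bar>k s - k (?x j)\<bar> \<le> g (t - ?x j) - g (t - s)" "0 \<le> g (t - s) - g (t - ?x (Suc j))"
            using g[of "t - s" "t - ?x j"] g[of "t - ?x (Suc j)" "t - s"] unfolding k_def by linarith+
          then show ?thesis by (simp add: G_def L_def algebra_simps)
        qed
        from integral_mult_mean_zero_bound[OF kj d(1) cont mean dev this]
        show ?thesis using False by (simp add: V_def)
      qed
    qed
    have "\<bar>integral {t0..t0 + real n * d} (\<lambda>s. k s * ?F 0 s)
      - (\<Sum>j<n. \<Sum>r=1..K. b d r (n - j) * ?F 0 (?x j + c r * d))
      - d ^ K * P / fact K * integral {t0..t0 + real n * d} (\<lambda>s. k s * ?F K s)\<bar>
      \<le> (1 + real K * W + \<bar>P\<bar>) * B * d ^ (K + 1) * integral {t0..t0 + real n * d} (\<lambda>s. \<bar>k s\<bar>)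
        + d ^ K * A * (\<Sum>j<n. V j)"
      unfolding P_def
    proof (rule composite_quadrature_error[OF assms(3) _ d(1) assms(5,6) _ W _ _ _ A B V[unfolded P_def]])
      show "k absolutely_integrable_on {t0..t0 + real n * d}" using k nd L by simp
      show "{t0..t0 + real n * d} \<subseteq> ?S" using nd L tT by simp
      fix j and p :: "real poly" assume jp: "j < n" "degree p \<le> K - 1"
      then have "local_integral \<alpha> lam t0 d n j (poly p) = quadrature K (b d) c t0 d n j (poly p)"
        using assms(7)[OF d(1) jp(1)] gn tT by (simp add: degree_of_precision_def)
      then show "integral {?x j..?x j + d} (\<lambda>s. k s * poly p s) = (\<Sum>r=1..K. b d r (n - j) * poly p (?x j + c r * d))"
        unfolding local_integral_def quadrature_def gn by (simp add: grid_def k_def algebra_simps)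
    next
      show "(?F i has_field_derivative ?F (Suc i) x) (at x within ?S)" if "x \<in> ?S" "i \<le> K" for i x
        using that by (intro nth_deriv_on_has_field_derivative[OF assms(4)]) auto
    qed auto
    \<comment> \<open>The sums over the initial data cancel, because the \<open>n\<close>-th grid
      point is \<open>t\<close>.\<close>
    moreover have "?err n = integral {t0..t0 + real n * d} (\<lambda>s. k s * ?F 0 s)
      - (\<Sum>j<n. \<Sum>r=1..K. b d r (n - j) * ?F 0 (?x j + c r * d))
      - d ^ K * P / fact K * integral {t0..t0 + real n * d} (\<lambda>s. k s * ?F K s)"
      unfolding fde_solution_def num_approx_def quadrature_def d_def[symmetric] gn
      using nd L by (simp add: grid_def k_def P_def)
    ultimately have E: "\<bar>?err n\<bar> \<le> C1 * d ^ (K + 1) + d ^ K * A * (\<Sum>j<n. V j)"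
      using nd L by (simp add: C1_def N_def mult_ac)
    \<comment> \<open>Both \<open>\<alpha> - \<mu>\<close> and \<open>1 - \<mu>\<close> are
      nonnegative and \<open>d \<le> L\<close>, so the surplus powers of \<open>d\<close> are
      absorbed into powers of \<open>L\<close>, here and in \<open>d1\<close>.\<close>
    have da: "d powr \<alpha> \<le> L powr (\<alpha> - \<mu>) * d powr \<mu>"
    proof -
      have "d powr \<alpha> = d powr (\<alpha> - \<mu>) * d powr \<mu>" by (simp flip: powr_add)
      also have "\<dots> \<le> L powr (\<alpha> - \<mu>) * d powr \<mu>"
        using d by (intro mult_right_mono powr_mono2) (auto simp: \<mu>_def)
      finally show ?thesis .
    qed
    have d1: "d \<le> L powr (1 - \<mu>) * d powr \<mu>"
    proof -
      have "d = d powr (1 - \<mu>) * d powr \<mu>" using d by (simp flip: powr_add)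
      also have "\<dots> \<le> L powr (1 - \<mu>) * d powr \<mu>"
        using d by (intro mult_right_mono powr_mono2) (auto simp: \<mu>_def)
      finally show ?thesis .
    qed
    have "(\<Sum>j<n. V j) = (\<Sum>j<n-1. V j) + V (n - 1)"
      using n by (cases n) auto
    also have "(\<Sum>j<n-1. V j) = 2 * d * (\<Sum>j<n-1. G j - G (Suc j))"
      by (simp add: V_def sum_distrib_left mult_ac)
    \<comment> \<open>The telescope ends at \<open>G (n - 1) = g d\<close>, one step short of the
      singularity.\<close>
    also have "(\<Sum>j<n-1. G j - G (Suc j)) = g L - g d"
      unfolding sum_lessThan_telescope' using n nd by (simp add: G_def of_nat_diff left_diff_distrib)
    also have "2 * d * (g L - g d) + V (n - 1) \<le> 2 * d * (C * d powr (\<mu> - 1)) + 2 * M * (L powr (\<alpha> - \<mu>) * d powr \<mu> / \<alpha>)"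
      using d gL da M assms(1) unfolding V_def if_True simp_thms
      by (intro add_mono mult_left_mono divide_right_mono) auto
    \<comment> \<open>The cell length \<open>d\<close> turns \<open>d powr (\<mu> - 1)\<close> into
      \<open>d powr \<mu>\<close>, the same order as the last cell.\<close>
    also have "\<dots> = (2 * C + 2 * M * L powr (\<alpha> - \<mu>) / \<alpha>) * d powr \<mu>"
      using d by (simp add: powr_diff algebra_simps)
    finally have "d ^ K * A * (\<Sum>j<n. V j) \<le> C2 * (d ^ K * d powr \<mu>)"
      using AB d by (simp add: C2_def mult_ac mult_left_mono)
    moreover have "C1 * d ^ (K + 1) \<le> C1 * L powr (1 - \<mu>) * (d ^ K * d powr \<mu>)"
      using mult_left_mono[OF d1, of "C1 * d ^ K"] C12 d by (simp add: mult_ac)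
    ultimately have "\<bar>?err n\<bar> \<le> (C1 * L powr (1 - \<mu>) + C2) * (d ^ K * d powr \<mu>)"
      using E by (simp add: algebra_simps)
    also have "d ^ K * d powr \<mu> = d powr (real K + \<mu>)"
      using d by (simp add: powr_add powr_realpow)
    finally show ?thesis unfolding d_def by simp
  qed
  show ?thesis
    unfolding \<mu>_def[symmetric]
    by (rule bigoI[of _ "C1 * L powr (1 - \<mu>) + C2"])
      (use main in \<open>auto intro: eventually_mono[OF eventually_ge_at_top[of 1]]\<close>)
qed

end
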